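(* Let $G$ be a graph and $X$ a metric space with $|X|>2$. Then $\lambda(G,X)=0$ if and only if $G$ is disconnected.
   Context: All graphs are finite and simple. For a graph $G$, $d_v$ denotes the degree of $v$, $u\sim v$ means adjacency, and $\mathrm{vol}(G)=\sum_v d_v$. For a metric space $(X,d)$ and $f:V(G)\to X$ set $R_f(G,X)=\frac{\mathrm{vol}(G)\sum_{u\sim v} d(f(u),f(v))^2}{\sum_{u,v} d(f(u),f(v))^2 d_u d_v}$, where the numerator sum is over edges of $G$ and the denominator sum over unordered pairs of vertices; $\lambda(G,X)=\inf_f R_f(G,X)$ over all $f:V(G)\to X$ with nonzero denominator.
   Formalization: The graph G is assumed nonempty and without isolated vertices (unless it is a single vertex); otherwise the claim fails, e.g. an edge plus an isolated vertex is disconnected but has λ(G,X)=2. The infimum over no maps is taken as +∞. *)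

theory Defs
  imports "HOL-Analysis.Analysis" "Graph_Theory.Graph_Theory"
begin

text \<open>
  Finite simple graphs are the symmetric digraphs of locale \<^term>\<open>graph\<close>: an edge
  between u and v is the pair of opposite arcs from u to v and from v to u, so the
  degree of v is \<^term>\<open>out_degree G v\<close> and a sum over edges is half the sum over arcs.
\<close>

definition vol :: "('a, 'b) pre_digraph \<Rightarrow> real" where
  "vol G = (\<Sum>v\<in>verts G. real (out_degree G v))"

definition edge_energy :: "('a, 'b) pre_digraph \<Rightarrow> ('x \<Rightarrow> 'x \<Rightarrow> real) \<Rightarrow> ('a \<Rightarrow> 'x) \<Rightarrow> real" where
  "edge_energy G d f = (\<Sum>e\<in>arcs G. (d (f (tail G e)) (f (head G e)))\<^sup>2) / 2"

text \<open>
  A sum over unordered pairs of vertices: half the sum over ordered pairs, the diagonal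
  contributing 0.
\<close>

definition pair_energy :: "('a, 'b) pre_digraph \<Rightarrow> ('x \<Rightarrow> 'x \<Rightarrow> real) \<Rightarrow> ('a \<Rightarrow> 'x) \<Rightarrow> real" where
  "pair_energy G d f =
     (\<Sum>u\<in>verts G. \<Sum>v\<in>verts G.
        (d (f u) (f v))\<^sup>2 * real (out_degree G u) * real (out_degree G v)) / 2"

definition rayleigh :: "('a, 'b) pre_digraph \<Rightarrow> ('x \<Rightarrow> 'x \<Rightarrow> real) \<Rightarrow> ('a \<Rightarrow> 'x) \<Rightarrow> real" where
  "rayleigh G d f = vol G * edge_energy G d f / pair_energy G d f"

text \<open>
  The infimum is taken in the extended reals, so that it is \<^term>\<open>\<infinity> :: ereal\<close>, and not 0,
  when no map has nonzero denominator (as for the one-vertex graph).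
\<close>

definition spectral_gap ::
  "('a, 'b) pre_digraph \<Rightarrow> 'x set \<Rightarrow> ('x \<Rightarrow> 'x \<Rightarrow> real) \<Rightarrow> ereal" where
  "spectral_gap G X d =
     (INF f\<in>{f \<in> verts G \<rightarrow> X. pair_energy G d f \<noteq> 0}. ereal (rayleigh G d f))"

text \<open>
  A vertex of degree 0 does not affect \<^term>\<open>rayleigh\<close> at all; an edge together with an
  isolated vertex, for instance, is disconnected but has spectral gap 2. The one-vertex graph
  is admitted, so every nonempty connected graph qualifies.
\<close>

definition no_isolated_verts :: "('a, 'b) pre_digraph \<Rightarrow> bool" where
  "no_isolated_verts G \<longleftrightarrow> (\<forall>v\<in>verts G. verts G \<noteq> {v} \<longrightarrow> out_degree G v > 0)"

end

theory Submission
  imports Defs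
begin

text \<open>
  If G is connected, the triangle inequality along a fixed path from u to v bounds every
  d(f(u), f(v)) by a multiple, independent of f, of the square root of the edge energy of f.
  Hence the pair energy is at most a constant times the edge energy, uniformly in f, and the
  Rayleigh quotient is bounded away from 0. If G is disconnected, a map that takes one value on a
  component and another value elsewhere has Rayleigh quotient 0.
\<close>

lemma edge_energy_nonneg: "0 \<le> edge_energy G d f"
  unfolding edge_energy_def by (simp add: sum_nonneg)

lemma vol_nonneg: "0 \<le> vol G"
  unfolding vol_def by (simp add: sum_nonneg)

lemma pair_energy_nonneg: "0 \<le> pair_energy G d f"
  unfolding pair_energy_def by (simp add: sum_nonneg)

lemma rayleigh_nonneg: "0 \<le> rayleigh G d f"
  unfolding rayleigh_def by (simp add: edge_energy_nonneg vol_nonneg pair_energy_nonneg)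

lemma spectral_gap_nonneg: "0 \<le> spectral_gap G X d"
  unfolding spectral_gap_def by (rule INF_greatest) (simp add: rayleigh_nonneg)

lemma spectral_gap_le_rayleigh:
  assumes "f \<in> verts G \<rightarrow> X" "pair_energy G d f \<noteq> 0"
  shows "spectral_gap G X d \<le> ereal (rayleigh G d f)"
  unfolding spectral_gap_def using assms by (intro INF_lower) auto

text \<open>Zero volume forces every degree to vanish, and each term of the pair energy carries
  degree factors.\<close>

lemma vol_pos_if_pair_energy_nonzero:
  assumes "finite (verts G)" "pair_energy G d f \<noteq> 0"
  shows "0 < vol G"
proof (rule ccontr)
  assume "\<not> 0 < vol G"
  then have "vol G = 0"
    using vol_nonneg[of G] by simp
  then have "\<forall>v\<in>verts G. out_degree G v = 0"
    unfolding vol_def using assms(1) by (subst (asm) sum_nonneg_eq_0_iff) auto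
  then have "pair_energy G d f = 0"
    unfolding pair_energy_def by simp
  then show False
    using assms(2) by simp
qed

text \<open>A single square is at most the whole sum over arcs; the factor 2 undoes the halving in
  \<open>edge_energy\<close>.\<close>

lemma (in fin_digraph) dist_arc_le_sqrt_edge_energy:
  assumes "e \<in> arcs G"
  shows "d (f (tail G e)) (f (head G e)) \<le> sqrt (2 * edge_energy G d f)"
proof (rule real_le_rsqrt)
  show "(d (f (tail G e)) (f (head G e)))\<^sup>2 \<le> 2 * edge_energy G d f"
    unfolding edge_energy_def
    using member_le_sum[of e "arcs G" "\<lambda>e. (d (f (tail G e)) (f (head G e)))\<^sup>2"] assms
    by simp
qed

text \<open>Each arc of a path from \<open>u\<close> to \<open>v\<close> costs at most one square
  root, so \<open>k\<close> counts arcs. It is quantified before \<open>f\<close>, which makes the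
  bound uniform over all maps.\<close>

lemma (in fin_digraph) dist_reachable_le_sqrt_edge_energy:
  assumes "Metric_space X d" "u \<rightarrow>\<^sup>*\<^bsub>G\<^esub> v"
  shows "\<exists>k::nat. \<forall>f\<in>verts G \<rightarrow> X. d (f u) (f v) \<le> real k * sqrt (2 * edge_energy G d f)"
  using assms(2)
proof (induction rule: reachable_induct)
  case base
  then have "d (f u) (f u) = 0" if "f \<in> verts G \<rightarrow> X" for f
    using that Metric_space.mdist_zero[OF assms(1)] by (auto simp: Pi_iff)
  then show ?case
    by (intro exI[of _ 0]) simp
next
  case (step x y)
  from step.IH obtain k :: nat
    where k: "\<And>f. f \<in> verts G \<rightarrow> X \<Longrightarrow> d (f u) (f x) \<le> real k * sqrt (2 * edge_energy G d f)"
    by blast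
  have "d (f u) (f y) \<le> real (Suc k) * sqrt (2 * edge_energy G d f)"
    if f: "f \<in> verts G \<rightarrow> X" for f
  proof -
    obtain e where "e \<in> arcs G" "tail G e = x" "head G e = y"
      using step.hyps(2) by blast
    then have "d (f x) (f y) \<le> sqrt (2 * edge_energy G d f)"
      using dist_arc_le_sqrt_edge_energy by metis
    \<comment> \<open>The metric axioms hold only on the carrier \<open>X\<close>, so the images
      must be placed there before the triangle inequality applies.\<close>
    moreover have "f u \<in> X" "f x \<in> X" "f y \<in> X"
      using f step.hyps reachable_in_verts adj_in_verts by blast+
    then have "d (f u) (f y) \<le> d (f u) (f x) + d (f x) (f y)"
      by (rule Metric_space.triangle[OF assms(1)])
    ultimately show ?thesis
      using k[OF f] by (simp add: algebra_simps)
  qed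
  then show ?case by blast
qed

lemma (in fin_digraph) pair_energy_le_edge_energy:
  assumes "Metric_space X d" "strongly_connected G"
  shows "\<exists>C\<ge>0. \<forall>f\<in>verts G \<rightarrow> X. pair_energy G d f \<le> C * edge_energy G d f"
proof -
  have "\<forall>u\<in>verts G. \<forall>v\<in>verts G. \<exists>k::nat. \<forall>f\<in>verts G \<rightarrow> X.
      d (f u) (f v) \<le> real k * sqrt (2 * edge_energy G d f)"
    using dist_reachable_le_sqrt_edge_energy[OF assms(1)] assms(2)
    by (simp add: strongly_connected_def)
  then obtain K :: "'a \<Rightarrow> 'a \<Rightarrow> nat" where K: "\<And>u v f. u \<in> verts G \<Longrightarrow> v \<in> verts G \<Longrightarrow>
      f \<in> verts G \<rightarrow> X \<Longrightarrow> d (f u) (f v) \<le> real (K u v) * sqrt (2 * edge_energy G d f)"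
    by metis
  \<comment> \<open>The 2 under the square root, once squared out, cancels the halving in
    \<open>pair_energy\<close>, so no numerical factor remains in \<open>C\<close>.\<close>
  define C where "C = (\<Sum>u\<in>verts G. \<Sum>v\<in>verts G.
      (real (K u v))\<^sup>2 * real (out_degree G u) * real (out_degree G v))"
  have "pair_energy G d f \<le> C * edge_energy G d f" if f: "f \<in> verts G \<rightarrow> X" for f
  proof -
    have "(d (f u) (f v))\<^sup>2 \<le> (real (K u v))\<^sup>2 * (2 * edge_energy G d f)"
      if "u \<in> verts G" "v \<in> verts G" for u v
    proof -
      have "(d (f u) (f v))\<^sup>2 \<le> (real (K u v) * sqrt (2 * edge_energy G d f))\<^sup>2"
        using K[OF that f] Metric_space.nonneg[OF assms(1)] by (rule power_mono)
      then show ?thesis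
        by (simp add: power_mult_distrib edge_energy_nonneg)
    qed
    then have "pair_energy G d f \<le> (\<Sum>u\<in>verts G. \<Sum>v\<in>verts G.
        (real (K u v))\<^sup>2 * (2 * edge_energy G d f) * real (out_degree G u) * real (out_degree G v)) / 2"
      unfolding pair_energy_def by (intro divide_right_mono sum_mono mult_right_mono) auto
    also have "\<dots> = C * edge_energy G d f"
      unfolding C_def by (simp add: sum_distrib_left sum_distrib_right sum_divide_distrib mult_ac)
    finally show ?thesis .
  qed
  moreover have "0 \<le> C"
    unfolding C_def by (simp add: sum_nonneg)
  ultimately show ?thesis by blast
qed

lemma (in fin_digraph) spectral_gap_pos_if_strongly_connected:
  assumes "Metric_space X d" "strongly_connected G"
  shows "0 < spectral_gap G X d"
proof (cases "vol G = 0")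
  case True
  \<comment> \<open>With zero volume no map is admissible, and the infimum over the empty set is
    infinity, hence positive.\<close>
  then have empty: "{f \<in> verts G \<rightarrow> X. pair_energy G d f \<noteq> 0} = {}"
    using vol_pos_if_pair_energy_nonzero[OF finite_verts] by force
  show ?thesis
    unfolding spectral_gap_def empty by (simp add: top_ereal_def)
next
  case False
  then have vol: "0 < vol G"
    using vol_nonneg[of G] by simp
  obtain C where C: "0 \<le> C"
    "\<And>f. f \<in> verts G \<rightarrow> X \<Longrightarrow> pair_energy G d f \<le> C * edge_energy G d f"
    using pair_energy_le_edge_energy[OF assms] by blast
  \<comment> \<open>Using \<open>C + 1\<close> instead of \<open>C\<close> keeps the divisor
    positive even when \<open>C\<close> is 0.\<close>
  have "vol G / (C + 1) \<le> rayleigh G d f"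
    if f: "f \<in> verts G \<rightarrow> X" and nz: "pair_energy G d f \<noteq> 0" for f
  proof -
    have "pair_energy G d f \<le> (C + 1) * edge_energy G d f"
      using C(2)[OF f] edge_energy_nonneg[of G d f] by (simp add: algebra_simps)
    then have "vol G * pair_energy G d f \<le> vol G * ((C + 1) * edge_energy G d f)"
      using vol by (simp add: mult_left_mono)
    moreover have "0 < pair_energy G d f"
      using nz pair_energy_nonneg[of G d f] by simp
    ultimately show ?thesis
      unfolding rayleigh_def using C(1) by (simp add: field_simps)
  qed
  then have "ereal (vol G / (C + 1)) \<le> spectral_gap G X d"
    unfolding spectral_gap_def by (intro INF_greatest) auto
  moreover have "0 < ereal (vol G / (C + 1))"
    using vol C(1) by simp
  ultimately show ?thesis by (rule order.strict_trans2[rotated])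
qed

lemma (in wf_digraph) strongly_connected_imp_connected:
  assumes "strongly_connected G"
  shows "connected G"
  using assms unfolding connected_def strongly_connected_def
  by (auto intro: reachable_mk_symmetricI)

text \<open>The infimum is attained: the two-valued map has no energy on arcs, while the pair
  \<open>u\<close>, \<open>v\<close> alone keeps the denominator positive because both degrees are
  positive.\<close>

lemma (in pseudo_graph) spectral_gap_eq_0_if_disconnected:
  assumes "Metric_space X d"
    and X: "a \<in> X" "b \<in> X" "a \<noteq> b"
    and uv: "u \<in> verts G" "v \<in> verts G" "\<not> u \<rightarrow>\<^sup>*\<^bsub>G\<^esub> v"
    and deg: "0 < out_degree G u" "0 < out_degree G v"
  shows "spectral_gap G X d = 0"
proof -
  define f where "f w = (if u \<rightarrow>\<^sup>*\<^bsub>G\<^esub> w then a else b)" for w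
  have f: "f \<in> verts G \<rightarrow> X"
    using X by (simp add: f_def)
  have same: "f (tail G e) = f (head G e)" if "e \<in> arcs G" for e
  proof -
    have "tail G e \<rightarrow>\<^bsub>G\<^esub> head G e"
      using that by (auto simp: arcs_ends_conv)
    \<comment> \<open>Since arcs can be reversed, an arc neither leaves nor enters the set reachable
      from \<open>u\<close>, so \<open>f\<close> agrees at its two ends.\<close>
    then have "tail G e \<rightarrow>\<^sup>*\<^bsub>G\<^esub> head G e" "head G e \<rightarrow>\<^sup>*\<^bsub>G\<^esub> tail G e"
      using symmetric_reachable' by blast+
    then show ?thesis
      unfolding f_def using reachable_trans by metis
  qed
  then have energy: "edge_energy G d f = 0"
    using f Metric_space.mdist_zero[OF assms(1)] unfolding edge_energy_def
    by (auto simp: same Pi_iff intro!: sum.neutral)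
  \<comment> \<open>Naming the summand lets the single positive term at \<open>u\<close>,
    \<open>v\<close> be compared with the double sum of nonnegative terms.\<close>
  define t where "t x y = (d (f x) (f y))\<^sup>2 * real (out_degree G x) * real (out_degree G y)" for x y
  have "f u = a" "f v = b"
    using uv by (auto simp: f_def)
  then have "0 < t u v"
    using X deg Metric_space.zero[OF assms(1)] by (simp add: t_def)
  also have "t u v \<le> (\<Sum>y\<in>verts G. t u y)"
    using uv by (intro member_le_sum) (auto simp: t_def)
  also have "\<dots> \<le> (\<Sum>x\<in>verts G. \<Sum>y\<in>verts G. t x y)"
    using uv by (intro member_le_sum[of u "verts G" "\<lambda>x. \<Sum>y\<in>verts G. t x y"])
      (auto simp: t_def intro!: sum_nonneg)
  finally have "pair_energy G d f \<noteq> 0"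
    unfolding pair_energy_def t_def by simp
  then have "spectral_gap G X d \<le> ereal (rayleigh G d f)"
    using f by (rule spectral_gap_le_rayleigh[rotated])
  also have "\<dots> = 0"
    by (simp add: rayleigh_def energy)
  finally show ?thesis
    using spectral_gap_nonneg[of G X d] by (rule antisym)
qed

theorem theorem4p1:
  fixes G :: "('a, 'b) pre_digraph"
    and X :: "'x set"
    and d :: "'x \<Rightarrow> 'x \<Rightarrow> real"
  assumes "graph G"
    and "verts G \<noteq> {}"
    and "no_isolated_verts G"
    and "Metric_space X d"
    and "infinite X \<or> card X > 2"
  shows "spectral_gap G X d = 0 \<longleftrightarrow> \<not> Digraph_Component.connected G"
proof -
  interpret graph G by fact
  show ?thesis
  proof
    assume "spectral_gap G X d = 0"
    \<comment> \<open>The positive lower bound relies on directed paths; symmetry of the arcs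
      supplies them from connectedness.\<close>
    then show "\<not> Digraph_Component.connected G"
      using spectral_gap_pos_if_strongly_connected[OF assms(4)]
        symmetric_connected_imp_strongly_connected[OF sym_arcs] by auto
  next
    assume "\<not> Digraph_Component.connected G"
    then have "\<not> strongly_connected G"
      using strongly_connected_imp_connected by (rule contrapos_nn)
    \<comment> \<open>\<open>strongly_connected\<close> also demands a vertex, so nonemptiness of
      \<open>verts G\<close> is what turns its failure into an unreachable pair.\<close>
    then obtain u v where uv: "u \<in> verts G" "v \<in> verts G" "\<not> u \<rightarrow>\<^sup>*\<^bsub>G\<^esub> v"
      using assms(2) by (auto simp: strongly_connected_def)
    \<comment> \<open>Every vertex reaches itself. Two distinct vertices exclude the one-vertex
      exception in \<open>no_isolated_verts\<close>, so both degrees are positive.\<close>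
    then have "u \<noteq> v"
      by auto
    then have "verts G \<noteq> {w}" for w
      using uv by auto
    then have deg: "0 < out_degree G u" "0 < out_degree G v"
      using assms(3) uv by (auto simp: no_isolated_verts_def)
    \<comment> \<open>An infinite set has \<open>card\<close> 0, so the infinite and the finite case
      each need their own source of a two-element subset.\<close>
    obtain Y where "Y \<subseteq> X" "card Y = 2"
      using assms(5) infinite_arbitrarily_large[of X 2] obtain_subset_with_card_n[of 2 X]
      by (metis less_imp_le)
    then obtain a b where "a \<in> X" "b \<in> X" "a \<noteq> b"
      by (auto simp: card_2_iff)
    then show "spectral_gap G X d = 0"
      using spectral_gap_eq_0_if_disconnected[OF assms(4) _ _ _ uv deg] by blast
  qed
qed

end
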